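(* Let $\mathcal{A}$ be a complete Boolean algebra. There exists $u\in\mathbf{V}^{\mathcal{T}_{\mathcal{A}}}$ such that $\lbrack\!\lbrack u\approx u\rbrack\!\rbrack=\mathbf{\frac{1}{2}}$, where $\mathbf{\frac12}=(1,1)$.
   Context: Let $\mathcal{A}=\langle A,\wedge,\vee,\to,\sim,0,1\rangle$ be a complete Boolean algebra. Its twist domain is $T_{\mathcal{A}}=\{(z_1,z_2)\in A\times A : z_1\vee z_2=1\}$. The twist structure $\mathcal{T}_{\mathcal{A}}$ is $T_{\mathcal{A}}$ with, among others, the operations $(z_1,z_2)\tilde\wedge(w_1,w_2)=(z_1\wedge w_1,z_2\vee w_2)$ and $(z_1,z_2)\tilde\to(w_1,w_2)=(z_1\to w_1,z_1\wedge w_2)$. $T_{\mathcal{A}}$ is a complete lattice with order $z\le w$ iff $z_1\le w_1$ and $z_2\ge w_2$, so $\bigwedge_i z_i=(\bigwedge_i (z_i)_1,\bigvee_i (z_i)_2)$ and $\bigvee_i z_i=(\bigvee_i (z_i)_1,\bigwedge_i (z_i)_2)$. By transfinite recursion, $\mathbf{V}^{\mathcal{T}_{\mathcal{A}}}_\alpha=\{x : x$ is a function, $ran(x)\subseteq T_{\mathcal{A}}$ and $dom(x)\subseteq \mathbf{V}^{\mathcal{T}_{\mathcal{A}}}_\xi$ for some $\xi<\alpha\}$, and $\mathbf{V}^{\mathcal{T}_{\mathcal{A}}}=\bigcup_\alpha \mathbf{V}^{\mathcal{T}_{\mathcal{A}}}_\alpha$. For $u,v\in\mathbf{V}^{\mathcal{T}_{\mathcal{A}}}$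 the values $\lbrack\!\lbrack u\,\epsilon\, v\rbrack\!\rbrack,\lbrack\!\lbrack u\approx v\rbrack\!\rbrack\in T_{\mathcal{A}}$ are defined by simultaneous recursion: $\lbrack\!\lbrack u\,\epsilon\, v\rbrack\!\rbrack=\bigvee_{x\in dom(v)}(v(x)\,\tilde\wedge\,\lbrack\!\lbrack x\approx u\rbrack\!\rbrack)$ and $\lbrack\!\lbrack u\approx v\rbrack\!\rbrack=\bigwedge_{x\in dom(u)}(u(x)\,\tilde\to\,\lbrack\!\lbrack x\,\epsilon\, v\rbrack\!\rbrack)\ \tilde\wedge\ \bigwedge_{x\in dom(v)}(v(x)\,\tilde\to\,\lbrack\!\lbrack x\,\epsilon\, u\rbrack\!\rbrack)$. *)

theory Defs
  imports Main "HOL-Library.Multiset"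
begin

section \<open>Complete Boolean algebras\<close>

text \<open>
  A complete Boolean algebra is a type of sort \<open>{boolean_algebra, complete_lattice}\<close>.
  The library class \<open>complete_boolean_algebra\<close> would be too narrow: it extends
  \<open>complete_distrib_lattice\<close>, which demands complete distributivity, so that its
  instances are exactly the algebras isomorphic to a power set.
\<close>

lemma sup_Inf_ba:
  fixes a :: "'a::{boolean_algebra, complete_lattice}"
  shows "sup a (Inf B) = (INF b\<in>B. sup a b)"
proof (rule antisym)
  show "sup a (Inf B) \<le> (INF b\<in>B. sup a b)"
    by (auto intro!: INF_greatest intro: le_supI2 Inf_lower)
  have "inf (- a) (INF b\<in>B. sup a b) \<le> b" if "b \<in> B" for b
  proof -
    have "inf (- a) (INF b\<in>B. sup a b) \<le> inf (- a) (sup a b)"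
      by (rule inf_mono) (auto intro: INF_lower that)
    also have "\<dots> \<le> b"
      by (simp add: inf_sup_distrib1)
    finally show ?thesis .
  qed
  then have "inf (- a) (INF b\<in>B. sup a b) \<le> Inf B"
    by (rule Inf_greatest)
  then have "sup a (inf (- a) (INF b\<in>B. sup a b)) \<le> sup a (Inf B)"
    by (rule sup_mono[OF order_refl])
  then show "(INF b\<in>B. sup a b) \<le> sup a (Inf B)"
    by (simp add: sup_inf_distrib1)
qed


section \<open>The twist domain\<close>

typedef (overloaded) 'a twist =
  "{z :: 'a::{boolean_algebra, complete_lattice} \<times> 'a. sup (fst z) (snd z) = top}"
  by (rule exI[of _ "(top, top)"]) simp

setup_lifting type_definition_twist

lemma twist_sup_top [simp]:
  "sup (fst (Rep_twist z)) (snd (Rep_twist z)) = top"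
  using Rep_twist[of z] by simp

lemma twist_Sup_aux:
  fixes f g :: "'i \<Rightarrow> 'a::{boolean_algebra, complete_lattice}"
  assumes "\<And>i. i \<in> I \<Longrightarrow> sup (f i) (g i) = top"
  shows "sup (SUP i\<in>I. f i) (INF i\<in>I. g i) = top"
proof -
  have "sup (SUP i\<in>I. f i) (g j) = top" if "j \<in> I" for j
    using assms[OF that] that
    by (metis SUP_upper sup.absorb_iff1 sup.left_commute sup.commute sup_top_right)
  then show ?thesis
    by (simp add: sup_Inf_ba image_image)
qed

lemma twist_Inf_aux:
  fixes f g :: "'i \<Rightarrow> 'a::{boolean_algebra, complete_lattice}"
  assumes "\<And>i. i \<in> I \<Longrightarrow> sup (f i) (g i) = top"
  shows "sup (INF i\<in>I. f i) (SUP i\<in>I. g i) = top"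
  using twist_Sup_aux[of I g f] assms by (simp add: sup.commute)

text \<open>The second coordinate is ordered in reverse.\<close>

instantiation twist :: ("{boolean_algebra, complete_lattice}") complete_lattice
begin

lift_definition less_eq_twist :: "'a twist \<Rightarrow> 'a twist \<Rightarrow> bool"
  is "\<lambda>z w. fst z \<le> fst w \<and> snd w \<le> snd z" .

definition less_twist :: "'a twist \<Rightarrow> 'a twist \<Rightarrow> bool"
  where "less_twist z w \<longleftrightarrow> z \<le> w \<and> \<not> w \<le> z"

lift_definition inf_twist :: "'a twist \<Rightarrow> 'a twist \<Rightarrow> 'a twist"
  is "\<lambda>z w. (inf (fst z) (fst w), sup (snd z) (snd w))"
  by (simp add: sup_inf_distrib2 sup.assoc[symmetric])
     (metis sup.assoc sup.commute sup_top_left)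

lift_definition sup_twist :: "'a twist \<Rightarrow> 'a twist \<Rightarrow> 'a twist"
  is "\<lambda>z w. (sup (fst z) (fst w), inf (snd z) (snd w))"
  by (simp add: sup_inf_distrib1)
     (metis sup.assoc sup.commute sup_top_left)

lift_definition top_twist :: "'a twist" is "(top, bot)" by simp

lift_definition bot_twist :: "'a twist" is "(bot, top)" by simp

lift_definition Inf_twist :: "'a twist set \<Rightarrow> 'a twist"
  is "\<lambda>Z. (INF z\<in>Z. fst z, SUP z\<in>Z. snd z)"
  by (simp add: twist_Inf_aux)

lift_definition Sup_twist :: "'a twist set \<Rightarrow> 'a twist"
  is "\<lambda>Z. (SUP z\<in>Z. fst z, INF z\<in>Z. snd z)"
  by (simp add: twist_Sup_aux)

instance
proof
  fix x y z :: "'a twist" and Z :: "'a twist set"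
  show "x < y \<longleftrightarrow> x \<le> y \<and> \<not> y \<le> x" by (rule less_twist_def)
  show "x \<le> x" by transfer simp
  show "x \<le> y \<Longrightarrow> y \<le> z \<Longrightarrow> x \<le> z" by transfer auto
  show "x \<le> y \<Longrightarrow> y \<le> x \<Longrightarrow> x = y" by transfer (auto simp: prod_eq_iff)
  show "inf x y \<le> x" "inf x y \<le> y" by (transfer, simp)+
  show "x \<le> y \<Longrightarrow> x \<le> z \<Longrightarrow> x \<le> inf y z" by transfer simp
  show "x \<le> sup x y" "y \<le> sup x y" by (transfer, simp)+
  show "y \<le> x \<Longrightarrow> z \<le> x \<Longrightarrow> sup y z \<le> x" by transfer simp
  show "x \<in> Z \<Longrightarrow> Inf Z \<le> x" by transfer (auto intro: INF_lower SUP_upper)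
  show "(\<And>x. x \<in> Z \<Longrightarrow> z \<le> x) \<Longrightarrow> z \<le> Inf Z"
    unfolding Ball_def[symmetric] by transfer (auto intro!: INF_greatest SUP_least)
  show "x \<in> Z \<Longrightarrow> x \<le> Sup Z" by transfer (auto intro: INF_lower SUP_upper)
  show "(\<And>x. x \<in> Z \<Longrightarrow> x \<le> z) \<Longrightarrow> Sup Z \<le> z"
    unfolding Ball_def[symmetric] by transfer (auto intro!: INF_greatest SUP_least)
  show "Inf {} = (top :: 'a twist)" by transfer simp
  show "Sup {} = (bot :: 'a twist)" by transfer simp
qed

end

text \<open>In a Boolean algebra \<open>a \<rightarrow> b\<close> is \<open>sup (- a) b\<close>.\<close>

lift_definition twist_imp ::
  "'a::{boolean_algebra, complete_lattice} twist \<Rightarrow> 'a twist \<Rightarrow> 'a twist"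
  (infixr "\<rightarrow>\<^sub>T" 60)
  is "\<lambda>z w. (sup (- fst z) (fst w), inf (fst z) (snd w))"
  by (simp add: sup_inf_distrib1 sup.assoc)

lift_definition half :: "'a::{boolean_algebra, complete_lattice} twist"
  is "(top, top)" by simp


section \<open>The ambient universe of sets\<close>

text \<open>
  The type \<open>'v\<close> is the class of all sets, and \<open>elts x\<close> is the class of
  the members of the set \<open>x\<close>. As \<open>f\<close> ranges over all functions of the
  logic, the last axiom is second-order replacement, so every subclass of a set is a set.
  All axioms hold in every universe of ZFC sets. Infinity and power set are not assumed,
  so the locale also covers the sets of hereditary cardinality at most \<open>\<kappa>\<close>, for
  each infinite \<open>\<kappa>\<close>.
\<close>

locale set_universe =
  fixes elts :: "'v \<Rightarrow> 'v set"
  assumes extensionality: "elts x = elts y \<Longrightarrow> x = y"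
    and foundation: "wf {(x, y). x \<in> elts y}"
    and pairing: "\<exists>z. elts z = {x, y}"
    and union: "\<exists>z. elts z = \<Union> (elts ` elts x)"
    and replacement: "\<exists>z. elts z = f ` elts x"
begin

definition upair :: "'v \<Rightarrow> 'v \<Rightarrow> 'v"
  where "upair x y = (THE z. elts z = {x, y})"

definition opair :: "'v \<Rightarrow> 'v \<Rightarrow> 'v"
  where "opair x y = upair (upair x x) (upair x y)"

lemma elts_upair [simp]: "elts (upair x y) = {x, y}"
  unfolding upair_def using pairing[of x y] extensionality by (metis (mono_tags, lifting) theI')

lemma opair_inject [simp]: "opair x y = opair x' y' \<longleftrightarrow> x = x' \<and> y = y'"
proof -
  have "upair a b = upair c d \<longleftrightarrow> {a, b} = {c, d}" for a b c d
    by (metis elts_upair extensionality)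
  then show ?thesis
    unfolding opair_def by (auto simp: doubleton_eq_iff)
qed

definition is_fun :: "'v \<Rightarrow> bool"
  where "is_fun f \<longleftrightarrow> (\<forall>p\<in>elts f. \<exists>x y. p = opair x y) \<and>
    (\<forall>x y z. opair x y \<in> elts f \<longrightarrow> opair x z \<in> elts f \<longrightarrow> y = z)"

definition dom :: "'v \<Rightarrow> 'v set"
  where "dom f = {x. \<exists>y. opair x y \<in> elts f}"

definition ran :: "'v \<Rightarrow> 'v set"
  where "ran f = {y. \<exists>x. opair x y \<in> elts f}"

definition transitive :: "'v \<Rightarrow> bool"
  where "transitive x \<longleftrightarrow> (\<forall>y\<in>elts x. elts y \<subseteq> elts x)"

definition ordinal :: "'v \<Rightarrow> bool"
  where "ordinal \<alpha> \<longleftrightarrow> transitive \<alpha> \<and> (\<forall>\<xi>\<in>elts \<alpha>. transitive \<xi>)"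

lemma wf_dom: "wf {(x, f). x \<in> dom f}"
proof (rule wf_subset[OF wf_trancl[OF foundation]], clarify)
  fix x f assume "x \<in> dom f"
  then obtain y where "opair x y \<in> elts f" by (auto simp: dom_def)
  moreover have "x \<in> elts (upair x x)" "upair x x \<in> elts (opair x y)"
    by (simp_all add: opair_def)
  ultimately show "(x, f) \<in> {(x, y). x \<in> elts y}\<^sup>+"
    by (meson CollectI case_prodI r_into_trancl' trancl_into_trancl)
qed

end


section \<open>The twist-valued universe\<close>

text \<open>
  The algebra is a type \<open>'a\<close>; the injection \<open>code\<close> makes it (a copy of) a set of
  the ambient universe, so that its elements may occur in set-theoretic functions.
\<close>

locale twist_universe = set_universe elts
  for elts :: "'v \<Rightarrow> 'v set" +
  fixes code :: "'a::{boolean_algebra, complete_lattice} \<Rightarrow> 'v"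
  assumes inj_code: "inj code"
    and range_code: "\<exists>A. elts A = range code"
begin

definition tcode :: "'a twist \<Rightarrow> 'v"
  where "tcode z = opair (code (fst (Rep_twist z))) (code (snd (Rep_twist z)))"

lemma inj_tcode: "inj tcode"
  by (rule injI)
     (auto simp: tcode_def inj_eq[OF inj_code] Rep_twist_inject[symmetric] prod_eq_iff)

function V_stage :: "'v \<Rightarrow> 'v set"
  where "V_stage \<alpha> = {x. is_fun x \<and> ran x \<subseteq> range tcode \<and> (\<exists>\<xi>\<in>elts \<alpha>. dom x \<subseteq> V_stage \<xi>)}"
  by auto
termination
  by (relation "{(x, y). x \<in> elts y}") (auto simp: foundation)

definition V_twist :: "'v set"
  where "V_twist = (\<Union>\<alpha>\<in>{\<alpha>. ordinal \<alpha>}. V_stage \<alpha>)"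

text \<open>
  The value \<open>u(x)\<close>, read back as an element of \<open>'a twist\<close>.
  It is meaningful for \<open>u \<in> V_twist\<close> and \<open>x \<in> dom u\<close>; on other
  arguments the functions below are total but irrelevant.
\<close>

definition val :: "'v \<Rightarrow> 'v \<Rightarrow> 'a twist"
  where "val u x = (THE z. opair x (tcode z) \<in> elts u)"

function mem_value :: "'v \<Rightarrow> 'v \<Rightarrow> 'a twist" and eq_value :: "'v \<Rightarrow> 'v \<Rightarrow> 'a twist"
  where
    "mem_value u v = (SUP x\<in>dom v. inf (val v x) (eq_value x u))"
  | "eq_value u v =
      inf (INF x\<in>dom u. val u x \<rightarrow>\<^sub>T mem_value x v)
          (INF x\<in>dom v. val v x \<rightarrow>\<^sub>T mem_value x u)"
  by pat_completeness auto
termination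
proof (relation "inv_image (mult {(x, f). x \<in> dom f})
    (\<lambda>p. case p of Inl (u, v) \<Rightarrow> {#u, v#} | Inr (u, v) \<Rightarrow> {#u, v#})")
  show "wf (inv_image (mult {(x, f). x \<in> dom f})
    (\<lambda>p. case p of Inl (u, v) \<Rightarrow> {#u, v#} | Inr (u, v) \<Rightarrow> {#u, v#}))"
    by (intro wf_inv_image wf_mult wf_dom)
  have step: "({#x, w#}, {#f, w#}) \<in> mult {(x, f). x \<in> dom f}" if "x \<in> dom f" for x f w
    using one_step_implies_mult[of "{#f#}" "{#x#}" "{(x, f). x \<in> dom f}" "{#w#}"] that
    by (simp add: add_mset_commute)
  fix u v x
  {
    assume "x \<in> dom v"
    from step[OF this, of u]
    show "(Inr (x, u), Inl (u, v)) \<in> inv_image (mult {(x, f). x \<in> dom f})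
        (\<lambda>p. case p of Inl (u, v) \<Rightarrow> {#u, v#} | Inr (u, v) \<Rightarrow> {#u, v#})"
      by (simp add: add_mset_commute)
  next
    assume "x \<in> dom u"
    from step[OF this, of v]
    show "(Inl (x, v), Inr (u, v)) \<in> inv_image (mult {(x, f). x \<in> dom f})
        (\<lambda>p. case p of Inl (u, v) \<Rightarrow> {#u, v#} | Inr (u, v) \<Rightarrow> {#u, v#})"
      by simp
  next
    assume "x \<in> dom v"
    from step[OF this, of u]
    show "(Inl (x, u), Inr (u, v)) \<in> inv_image (mult {(x, f). x \<in> dom f})
        (\<lambda>p. case p of Inl (u, v) \<Rightarrow> {#u, v#} | Inr (u, v) \<Rightarrow> {#u, v#})"
      by (simp add: add_mset_commute)
  }
qed

declare V_stage.simps [simp del] mem_value.simps [simp del] eq_value.simps [simp del]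

end

section \<open>Existence of universes\<close>

text \<open>
  For every algebra \<open>'a\<close> the assumptions of \<^locale>\<open>twist_universe\<close> are satisfiable:
  take the sets of hereditary cardinality at most that of an infinite type \<open>'i\<close>, as
  well-founded \<open>'i\<close>-branching trees modulo extensional equality.
\<close>

unbundle cardinal_syntax

datatype 'i htree = HLeaf | HNode "'i set" "'i \<Rightarrow> 'i htree"

primrec hchildren where "hchildren HLeaf = {}" | "hchildren (HNode I f) = f ` I"

primrec bisim :: "'i htree \<Rightarrow> 'i htree \<Rightarrow> bool" where
  "bisim HLeaf = (\<lambda>t. hchildren t = {})"
| "bisim (HNode I f) = (\<lambda>t. (\<forall>i\<in>I. \<exists>y\<in>hchildren t. bisim (f i) y) \<and> (\<forall>y\<in>hchildren t. \<exists>i\<in>I. bisim (f i) y))"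

lemma bisim_iff: "bisim s t \<longleftrightarrow> (\<forall>x\<in>hchildren s. \<exists>y\<in>hchildren t. bisim x y) \<and> (\<forall>y\<in>hchildren t. \<exists>x\<in>hchildren s. bisim x y)"
  by (cases s) auto

lemma htree_induct: "(\<And>t. (\<And>x. x \<in> hchildren t \<Longrightarrow> P x) \<Longrightarrow> P t) \<Longrightarrow> P t"
proof (induction t)
  case HLeaf
  show ?case by (rule HLeaf) simp
next
  case (HNode I f)
  show ?case by (rule HNode.prems) (use HNode in auto)
qed

lemma bisim_refl: "bisim t t"
  by (induction t rule: htree_induct) (subst bisim_iff, blast)

lemma bisim_sym: "bisim s t \<Longrightarrow> bisim t s"
proof (induction s arbitrary: t rule: htree_induct)
  case (1 s) show ?case using 1(2) unfolding bisim_iff[of s t] bisim_iff[of t s] using 1(1) by blast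
qed

lemma bisim_trans: "bisim s t \<Longrightarrow> bisim t r \<Longrightarrow> bisim s r"
proof (induction s arbitrary: t r rule: htree_induct)
  case (1 s) show ?case using 1(2,3) unfolding bisim_iff[of s t] bisim_iff[of t r] bisim_iff[of s r] using 1(1) by meson
qed

quotient_type 'i hset = "'i htree" / bisim
  by (rule equivpI) (auto intro!: reflpI sympI transpI intro: bisim_refl bisim_sym bisim_trans)

definition helts :: "'i hset \<Rightarrow> 'i hset set" where "helts x = abs_hset ` hchildren (rep_hset x)"

lemma abs_hset_eq_iff: "abs_hset s = abs_hset t \<longleftrightarrow> bisim s t"
  by (simp add: hset.abs_eq_iff)

lemma bisim_rep: "bisim (rep_hset (abs_hset t)) t"
  using Quotient3_abs_rep[OF Quotient3_hset, of "abs_hset t"] by (simp only: abs_hset_eq_iff)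

lemma helts_abs: "helts (abs_hset t) = abs_hset ` hchildren t"
proof -
  have "bisim (rep_hset (abs_hset t)) t" by (rule bisim_rep)
  then show ?thesis unfolding helts_def bisim_iff[of "rep_hset (abs_hset t)"]
    by (auto simp: image_iff abs_hset_eq_iff) (blast dest: bisim_sym)+
qed

lemma hset_cases: obtains t where "x = abs_hset t"
  using Quotient3_abs_rep[OF Quotient3_hset, of x] by metis

lemma helts_ext: "x = y" if a: "helts x = helts y"
proof -
  obtain s where s: "x = abs_hset s" by (rule hset_cases)
  obtain t where t: "y = abs_hset t" by (rule hset_cases)
  have *: "abs_hset ` hchildren s = abs_hset ` hchildren t"
    using a by (simp add: s t helts_abs)
  have "\<exists>q\<in>hchildren t. bisim p q" if "p \<in> hchildren s" for p
  proof -
    have "abs_hset p \<in> abs_hset ` hchildren t"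
      using that unfolding *[symmetric] by (rule imageI)
    then show ?thesis by (auto simp: abs_hset_eq_iff)
  qed
  moreover have "\<exists>p\<in>hchildren s. bisim p q" if "q \<in> hchildren t" for q
  proof -
    have "abs_hset q \<in> abs_hset ` hchildren s"
      using that unfolding * by (rule imageI)
    then show ?thesis by (auto simp: abs_hset_eq_iff) (blast dest: bisim_sym)
  qed
  ultimately show ?thesis
    unfolding s t abs_hset_eq_iff bisim_iff[of s t] by blast
qed

lemma helts_wf: "wf {(x, y :: 'i hset). x \<in> helts y}"
proof (rule wfUNIVI)
  fix P :: "'i hset \<Rightarrow> bool" and x :: "'i hset" assume a: "\<forall>x. (\<forall>y. (y, x) \<in> {(x, y). x \<in> helts y} \<longrightarrow> P y) \<longrightarrow> P x"
  have "P (abs_hset t)" for t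
  proof (induction t rule: htree_induct)
    case (1 t)
    have "\<forall>y. y \<in> helts (abs_hset t) \<longrightarrow> P y" using 1 by (auto simp: helts_abs)
    then show ?case using a by blast
  qed
  then show "P x" by (cases x rule: hset_cases) simp
qed

lemma hset_of_image: "\<exists>z. helts z = h ` (I::'i set)" for h :: "'i \<Rightarrow> 'i hset"
  by (rule exI[of _ "abs_hset (HNode I (\<lambda>i. rep_hset (h i)))"])
     (simp add: helts_abs image_image Quotient3_abs_rep[OF Quotient3_hset])

lemma helts_image: "\<exists>(I::'i set) h. helts (z::'i hset) = h ` I"
  by (cases "rep_hset z") (auto simp: helts_def image_image)

lemma hset_of_small:
  assumes "|X| \<le>o |UNIV::'i set|"
  shows "\<exists>z::'i hset. helts z = X"
proof (cases "X = {}")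
  case True
  then show ?thesis using hset_of_image[of undefined "{}"] by simp
next
  case False
  then obtain h :: "'i \<Rightarrow> 'i hset" where "h ` UNIV = X"
    using card_of_ordLeq2[OF False, of "UNIV :: 'i set"] assms by blast
  then show ?thesis using hset_of_image[of h UNIV] by simp
qed

lemma card_helts: "|helts (z::'i hset)| \<le>o |UNIV::'i set|"
proof -
  obtain I :: "'i set" and h where z: "helts z = h ` I"
    using helts_image[of z] by blast
  show ?thesis
    unfolding z by (rule ordLeq_transitive[OF card_of_image card_of_mono1]) simp
qed

lemma hset_universe: assumes "infinite (UNIV::'i set)"
  shows "set_universe (helts :: 'i hset \<Rightarrow> _)"
proof
  fix x y :: "'i hset" and f :: "'i hset \<Rightarrow> 'i hset"
  show "helts x = helts y \<Longrightarrow> x = y" by (rule helts_ext)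
  show "wf {(x, y). x \<in> helts (y::'i hset)}" by (rule helts_wf)
  show "\<exists>z. helts z = {x, y}" 
  proof -
    define a :: 'i where "a = undefined"
    obtain b :: 'i where "b \<noteq> a"
      using assms ex_new_if_finite[of "{a}"] by auto
    then show ?thesis
      using hset_of_image[of "\<lambda>i. if i = a then x else y" "{a, b}"] by (simp add: insert_commute)
  qed
  show "\<exists>z. helts z = \<Union> (helts ` helts x)"
    by (rule hset_of_small) (intro card_of_UNION_ordLeq_infinite assms ballI card_helts)
  show "\<exists>z. helts z = f ` helts x"
    by (rule hset_of_small) (rule ordLeq_transitive[OF card_of_image card_helts])
qed

lemma twist_universe_exists:
  assumes "infinite (UNIV::'i set)" and "|UNIV :: 'a::{boolean_algebra, complete_lattice} set| \<le>o |UNIV::'i set|"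
  shows "\<exists>code :: 'a \<Rightarrow> 'i hset. twist_universe helts code"
proof -
  obtain r :: "'i rel" where r: "well_order_on UNIV r" using well_order_on by blast
  then have wfr: "wf (r - Id)" by (simp add: well_order_on_def)
  define F where "F g i = (SOME z. helts z = g ` {j. (j,i) \<in> r - Id})" for g :: "'i \<Rightarrow> 'i hset" and i
  define c where "c = wfrec (r - Id) F"
  have ad: "adm_wf (r - Id) F" unfolding adm_wf_def F_def
    by (auto cong: image_cong_simp) 
  have c: "helts (c i) = c ` {j. (j,i) \<in> r - Id}" for i
  proof -
    have "c i = F c i" unfolding c_def by (rule wfrec_fixpoint[OF wfr ad, THEN fun_cong])
    then show ?thesis unfolding F_def using someI_ex[OF hset_of_image] by metis
  qed
  have "inj c"
  proof (rule injI, rule ccontr)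
    fix i j assume h: "c i = c j" "i \<noteq> j"
    then have "(i,j) \<in> r - Id \<or> (j,i) \<in> r - Id" using r
      by (auto simp: well_order_on_def linear_order_on_def total_on_def)
    then have "c i \<in> helts (c i)" using h c by (metis (mono_tags, lifting) imageI mem_Collect_eq)
    then show False using wf_not_refl[OF helts_wf, of "c i"] by simp
  qed
  obtain g :: "'a \<Rightarrow> 'i" where g: "inj g" using assms(2) card_of_ordLeq[of "UNIV :: 'a set"] by metis
  have "inj (c \<circ> g)" using \<open>inj c\<close> g by (rule inj_compose)
  moreover have "\<exists>A. helts A = range (c \<circ> g)"
    using hset_of_image[of c "range g"] by (simp add: image_comp)
  ultimately have "twist_universe helts (c \<circ> g)"
    using hset_universe[OF assms(1)] by (simp add: twist_universe_def twist_universe_axioms_def)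
  then show ?thesis by blast
qed

unbundle no cardinal_syntax

end

theory Submission
  imports Defs
begin

text \<open>
  The witness is the name \<open>u = {(\<emptyset>, half)}\<close>. The empty name is equal to itself with value
  \<open>top\<close>, because that value is an infimum over an empty index set. Hence the value of
  \<open>\<emptyset>\<close> belonging to a singleton name \<open>{(\<emptyset>, z)}\<close> is just \<open>z\<close>, and the value of
  the singleton name being equal to itself is the self-implication \<open>z \<rightarrow>\<^sub>T z\<close>.
  In contrast with a Boolean algebra, self-implication need not be \<open>top\<close> in the twist structure:
  the second coordinate of \<open>z \<rightarrow>\<^sub>T z\<close> is the meet of the two coordinates of \<open>z\<close>,
  so that a contradictory \<open>z\<close> gives a contradictory self-identity. At \<open>z = half\<close> both
  coordinates are \<open>top\<close>.
\<close>

lemma twist_imp_half_half: "half \<rightarrow>\<^sub>T half = half"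
  by transfer simp

context set_universe
begin

text \<open>
  Neither an empty set nor separation is among the axioms; the empty set is found as a
  membership-minimal element of the universe.
\<close>

lemma empty_set_exists: "\<exists>e. elts e = {}"
proof -
  obtain e where "\<And>y. (y, e) \<in> {(x, y). x \<in> elts y} \<Longrightarrow> y \<notin> UNIV"
    using wfE_min[OF foundation UNIV_I] by metis
  then show ?thesis
    by blast
qed

lemma ordinal_two:
  assumes "elts e = {}"
  shows "ordinal (upair e (upair e e))"
  using assms by (auto simp: ordinal_def transitive_def)

lemma is_fun_empty: "elts e = {} \<Longrightarrow> is_fun e"
  by (simp add: is_fun_def)

lemma dom_empty: "elts e = {} \<Longrightarrow> dom e = {}"
  by (simp add: dom_def)

lemma ran_empty: "elts e = {} \<Longrightarrow> ran e = {}"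
  by (simp add: ran_def)

lemma is_fun_singleton: "elts u = {opair x y} \<Longrightarrow> is_fun u"
  by (auto simp: is_fun_def)

lemma dom_singleton: "elts u = {opair x y} \<Longrightarrow> dom u = {x}"
  by (auto simp: dom_def)

lemma ran_singleton: "elts u = {opair x y} \<Longrightarrow> ran u = {y}"
  by (auto simp: ran_def)

end

context twist_universe
begin

lemma val_singleton:
  assumes "elts u = {opair x (tcode z)}"
  shows "val u x = z"
  using assms by (simp add: val_def inj_eq[OF inj_tcode])

lemma empty_in_V_stage:
  assumes "elts e = {}" and "\<xi> \<in> elts \<alpha>"
  shows "e \<in> V_stage \<alpha>"
  using assms by (auto simp: V_stage.simps[of \<alpha>] is_fun_empty dom_empty ran_empty)

lemma singleton_in_V_twist:
  assumes "elts e = {}" and u: "elts u = {opair e (tcode z)}"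
  shows "u \<in> V_twist"
proof -
  \<comment> \<open>The empty name appears at stage 1, hence the singleton at stage 2.\<close>
  have "e \<in> V_stage (upair e e)"
    using assms(1) by (rule empty_in_V_stage[where \<xi> = e]) simp
  then have "u \<in> V_stage (upair e (upair e e))"
    using u by (auto simp: V_stage.simps[of "upair e (upair e e)"]
        is_fun_singleton dom_singleton ran_singleton)
  then show ?thesis
    using ordinal_two[OF assms(1)] by (auto simp: V_twist_def)
qed

lemma eq_value_empty:
  assumes "elts e = {}"
  shows "eq_value e e = top"
  using assms by (simp add: eq_value.simps[of e e] dom_empty)

lemma mem_value_empty_singleton:
  assumes "elts e = {}" and "elts u = {opair e (tcode z)}"
  shows "mem_value e u = z"
  using assms
  by (simp add: mem_value.simps[of e u] dom_singleton val_singleton eq_value_empty)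

lemma eq_value_singleton_self:
  assumes "elts e = {}" and "elts u = {opair e (tcode z)}"
  shows "eq_value u u = z \<rightarrow>\<^sub>T z"
  using assms
  by (simp add: eq_value.simps[of u u] dom_singleton val_singleton mem_value_empty_singleton)

end

theorem proposition10p1:
  fixes elts :: "'v \<Rightarrow> 'v set"
    and code :: "'a::{boolean_algebra, complete_lattice} \<Rightarrow> 'v"
  assumes "twist_universe elts code"
  shows "\<exists>u \<in> twist_universe.V_twist elts code. twist_universe.eq_value elts code u u = half"
proof -
  interpret twist_universe elts code
    by (rule assms)
  obtain e where e: "elts e = {}"
    using empty_set_exists by blast
  obtain u where u: "elts u = {opair e (tcode half)}"
    using pairing[of "opair e (tcode half)" "opair e (tcode half)"] by auto
  have "eq_value u u = half"
    using eq_value_singleton_self[OF e u] by (simp add: twist_imp_half_half)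
  then show ?thesis
    using singleton_in_V_twist[OF e u] by blast
qed

end
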